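(* Let $\mathbf{k}$ be a field, let $n,k$ be non-negative integers, and let $A$ be an associative $\mathbf{k}$-algebra without unity given by $n+k$ generators and $k$ relations, i.e. $A=\mathbf{k}\langle x_1,\dots,x_{n+k}\rangle/\mathrm{id}(h_1,\dots,h_k)$ with $h_1,\dots,h_k\in\mathbf{k}\langle x_1,\dots,x_{n+k}\rangle$. If $A$ has an $n$-element system of generators $g_1,\dots,g_n$ (as a $\mathbf{k}$-algebra without unity), then $A$ is a free associative algebra without unity of rank $n$, i.e. $A\cong\mathbf{k}\langle z_1,\dots,z_n\rangle$.
   Context: All algebras are associative $\mathbf{k}$-algebras without unity (not required to have a unit). $\mathbf{k}\langle x_1,\dots,x_m\rangle$ denotes the free associative $\mathbf{k}$-algebra without unity on $x_1,\dots,x_m$: its $\mathbf{k}$-basis is the set of non-empty words in $x_1,\dots,x_m$, with multiplication given by concatenation, so its elements are noncommutative polynomials with zero constant term. $\mathrm{id}(h_1,\dots,h_k)$ is the two-sided ideal generated by $h_1,\dots,h_k$ (the smallest two-sided ideal, which is a $\mathbf{k}$-subspace, containing them). A system $g_1,\dots,g_n$ generates $A$ if every element of $A$ is of the form $\Phi(g_1,\dots,g_n)$ with $\Phi\in\mathbf{k}\langle z_1,\dots,z_n\rangle$. *)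

theory Defs
  imports "HOL-Library.Poly_Mapping" "HOL-Algebra.QuotRing" "HOL-Algebra.Module"
begin

text \<open>
  An algebra over the field \<open>'k\<close> is carried by the record \<^type>\<open>module\<close>. The record inherits a
  field \<open>one\<close>, which is meaningless here: it is left \<^const>\<open>undefined\<close> in every construction, and
  nothing below refers to it.
\<close>

locale nonunital_algebra = abelian_group A for A :: "('k::field, 'a) module" (structure) +
  assumes m_closed: "\<lbrakk>x \<in> carrier A; y \<in> carrier A\<rbrakk> \<Longrightarrow> x \<otimes> y \<in> carrier A"
    and m_assoc: "\<lbrakk>x \<in> carrier A; y \<in> carrier A; z \<in> carrier A\<rbrakk> \<Longrightarrow> (x \<otimes> y) \<otimes> z = x \<otimes> (y \<otimes> z)"
    and m_ldistr: "\<lbrakk>x \<in> carrier A; y \<in> carrier A; z \<in> carrier A\<rbrakk> \<Longrightarrow> (x \<oplus> y) \<otimes> z = x \<otimes> z \<oplus> y \<otimes> z"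
    and m_rdistr: "\<lbrakk>x \<in> carrier A; y \<in> carrier A; z \<in> carrier A\<rbrakk> \<Longrightarrow> z \<otimes> (x \<oplus> y) = z \<otimes> x \<oplus> z \<otimes> y"
    and s_closed: "x \<in> carrier A \<Longrightarrow> c \<odot> x \<in> carrier A"
    and s_ldistr: "x \<in> carrier A \<Longrightarrow> (c + d) \<odot> x = c \<odot> x \<oplus> d \<odot> x"
    and s_rdistr: "\<lbrakk>x \<in> carrier A; y \<in> carrier A\<rbrakk> \<Longrightarrow> c \<odot> (x \<oplus> y) = c \<odot> x \<oplus> c \<odot> y"
    and s_assoc: "x \<in> carrier A \<Longrightarrow> (c * d) \<odot> x = c \<odot> (d \<odot> x)"
    and s_one: "x \<in> carrier A \<Longrightarrow> 1 \<odot> x = x"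
    and s_left: "\<lbrakk>x \<in> carrier A; y \<in> carrier A\<rbrakk> \<Longrightarrow> (c \<odot> x) \<otimes> y = c \<odot> (x \<otimes> y)"
    and s_right: "\<lbrakk>x \<in> carrier A; y \<in> carrier A\<rbrakk> \<Longrightarrow> x \<otimes> (c \<odot> y) = c \<odot> (x \<otimes> y)"

definition nalg_hom :: "('k::field, 'a) module \<Rightarrow> ('k, 'b) module \<Rightarrow> ('a \<Rightarrow> 'b) set" where
  "nalg_hom A B = {f. f \<in> carrier A \<rightarrow> carrier B \<and>
     (\<forall>x\<in>carrier A. \<forall>y\<in>carrier A. f (x \<oplus>\<^bsub>A\<^esub> y) = f x \<oplus>\<^bsub>B\<^esub> f y) \<and>
     (\<forall>x\<in>carrier A. \<forall>y\<in>carrier A. f (x \<otimes>\<^bsub>A\<^esub> y) = f x \<otimes>\<^bsub>B\<^esub> f y) \<and>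
     (\<forall>c. \<forall>x\<in>carrier A. f (c \<odot>\<^bsub>A\<^esub> x) = c \<odot>\<^bsub>B\<^esub> f x)}"

definition nalg_isomorphic :: "('k::field, 'a) module \<Rightarrow> ('k, 'b) module \<Rightarrow> bool" where
  "nalg_isomorphic A B \<longleftrightarrow> (\<exists>f \<in> nalg_hom A B. bij_betw f (carrier A) (carrier B))"


section \<open>Ideals and quotients\<close>

definition nalg_ideal :: "('k::field, 'a) module \<Rightarrow> 'a set \<Rightarrow> bool" where
  "nalg_ideal A I \<longleftrightarrow> I \<subseteq> carrier A \<and> \<zero>\<^bsub>A\<^esub> \<in> I \<and>
     (\<forall>x\<in>I. \<forall>y\<in>I. x \<oplus>\<^bsub>A\<^esub> y \<in> I) \<and>
     (\<forall>c. \<forall>x\<in>I. c \<odot>\<^bsub>A\<^esub> x \<in> I) \<and>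
     (\<forall>a\<in>carrier A. \<forall>x\<in>I. a \<otimes>\<^bsub>A\<^esub> x \<in> I \<and> x \<otimes>\<^bsub>A\<^esub> a \<in> I)"

definition nalg_genideal :: "('k::field, 'a) module \<Rightarrow> 'a set \<Rightarrow> 'a set" where
  "nalg_genideal A S = \<Inter>{I. nalg_ideal A I \<and> S \<subseteq> I}"

text \<open>The ring operations are those of \<^const>\<open>FactRing\<close>.\<close>

definition nalg_quot :: "('k::field, 'a) module \<Rightarrow> 'a set \<Rightarrow> ('k, 'a set) module" where
  "nalg_quot A I =
     \<lparr>carrier = a_rcosets\<^bsub>A\<^esub> I, mult = rcoset_mult A I, one = undefined, zero = I,
      add = set_add A, smult = (\<lambda>c X. \<Union>x\<in>X. I +>\<^bsub>A\<^esub> (c \<odot>\<^bsub>A\<^esub> x))\<rparr>"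


section \<open>Free algebras\<close>

text \<open>
  Lists wrapped as a monoid written additively, so that the convolution product of
  \<^type>\<open>poly_mapping\<close> is the product of noncommutative polynomials.
\<close>

datatype 'x word = Word (letters: "'x list")

instantiation word :: (type) monoid_add
begin

definition zero_word :: "'a word" where
  "zero_word = Word []"

definition plus_word :: "'a word \<Rightarrow> 'a word \<Rightarrow> 'a word" where
  "plus_word u v = Word (letters u @ letters v)"

instance
  by standard (simp_all add: zero_word_def plus_word_def)

end

lemma letters_zero [simp]: "letters 0 = []"
  by (simp add: zero_word_def)

lemma letters_plus [simp]: "letters (u + v) = letters u @ letters v"
  by (simp add: plus_word_def)

text \<open>The generators are indexed by \<open>0, \<dots>, m - 1\<close>.\<close>

definition free_nalg :: "nat \<Rightarrow> ('k::field, nat word \<Rightarrow>\<^sub>0 'k) module" where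
  "free_nalg m =
     \<lparr>carrier = {p. \<forall>w\<in>Poly_Mapping.keys p. letters w \<noteq> [] \<and> set (letters w) \<subseteq> {..<m}},
      mult = (*), one = undefined, zero = 0, add = (+),
      smult = (\<lambda>c. Poly_Mapping.map ((*) c))\<rparr>"


section \<open>Evaluation and generators\<close>

text \<open>The empty word, for which there is no value without a unit, is not covered on purpose.\<close>

fun word_eval :: "('k::field, 'a) module \<Rightarrow> ('x \<Rightarrow> 'a) \<Rightarrow> 'x list \<Rightarrow> 'a" where
  "word_eval A g [x] = g x"
| "word_eval A g (x # y # ys) = g x \<otimes>\<^bsub>A\<^esub> word_eval A g (y # ys)"
| "word_eval A g [] = undefined"

definition nalg_eval :: "('k::field, 'a) module \<Rightarrow> ('x \<Rightarrow> 'a) \<Rightarrow> ('x word \<Rightarrow>\<^sub>0 'k) \<Rightarrow> 'a" where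
  "nalg_eval A g p =
     (\<Oplus>\<^bsub>A\<^esub>w\<in>Poly_Mapping.keys p. Poly_Mapping.lookup p w \<odot>\<^bsub>A\<^esub> word_eval A g (letters w))"

definition nalg_generates :: "('k::field, 'a) module \<Rightarrow> nat \<Rightarrow> (nat \<Rightarrow> 'a) \<Rightarrow> bool" where
  "nalg_generates A n g \<longleftrightarrow> (\<forall>i<n. g i \<in> carrier A) \<and>
     (\<forall>a\<in>carrier A. \<exists>p\<in>carrier (free_nalg n). a = nalg_eval A g p)"


section \<open>The constructions yield nonunital algebras\<close>

lemma lookup_scale:
  "Poly_Mapping.lookup (Poly_Mapping.map ((*) c) p) w = c * Poly_Mapping.lookup p w"
  for c :: "'k::field"
  by (simp add: Poly_Mapping.map.rep_eq when_def)

lemma scale_eq_single_mult: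
  "Poly_Mapping.map ((*) c) p = Poly_Mapping.single 0 c * p"
  for c :: "'k::field"
  by (rule poly_mapping_eqI) (simp add: lookup_scale lookup_mult lookup_single when_mult)

lemma mult_single_zero_commute:
  "p * Poly_Mapping.single 0 c = Poly_Mapping.single 0 c * p"
  for c :: "'k::field" and p :: "'x::monoid_add \<Rightarrow>\<^sub>0 'k"
proof (rule poly_mapping_eqI)
  fix w
  have "(\<Sum>q. (c when 0 = q) when w = l + q) = (c when l = w)" for l :: 'x
  proof -
    have "(\<Sum>q. (c when 0 = q) when w = l + q) = (\<Sum>q::'x. (c when l = w) when q = 0)"
      by (rule Sum_any.cong) (auto simp: when_def)
    then show ?thesis by simp
  qed
  then have "Poly_Mapping.lookup (p * Poly_Mapping.single 0 c) w = Poly_Mapping.lookup p w * c"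
    by (simp add: lookup_mult lookup_single mult_when)
  then show "Poly_Mapping.lookup (p * Poly_Mapping.single 0 c) w
      = Poly_Mapping.lookup (Poly_Mapping.single 0 c * p) w"
    by (simp add: scale_eq_single_mult [symmetric] lookup_scale mult.commute)
qed

lemma keys_scale: "Poly_Mapping.keys (Poly_Mapping.map ((*) c) p) \<subseteq> Poly_Mapping.keys p"
  for c :: "'k::field"
  by (auto simp: in_keys_iff lookup_scale)

lemma free_nalg_nonunital_algebra: "nonunital_algebra (free_nalg m :: ('k::field, _) module)"
proof -
  let ?F = "free_nalg m :: ('k, _) module"
  have add: "p + q \<in> carrier ?F" if "p \<in> carrier ?F" "q \<in> carrier ?F" for p q
    using that Poly_Mapping.keys_add [of p q] by (fastforce simp: free_nalg_def)
  have neg: "- p \<in> carrier ?F" if "p \<in> carrier ?F" for p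
    using that by (simp add: free_nalg_def)
  have mult: "p * q \<in> carrier ?F" if "p \<in> carrier ?F" "q \<in> carrier ?F" for p q
    using that keys_mult [of p q] by (fastforce simp: free_nalg_def)
  have scale: "Poly_Mapping.map ((*) c) p \<in> carrier ?F" if "p \<in> carrier ?F" for p c
    using that keys_scale [of c p] by (auto simp: free_nalg_def)
  have zero: "0 \<in> carrier ?F"
    by (simp add: free_nalg_def)
  have ops: "p \<otimes>\<^bsub>?F\<^esub> q = p * q" "p \<oplus>\<^bsub>?F\<^esub> q = p + q" "\<zero>\<^bsub>?F\<^esub> = 0"
    "c \<odot>\<^bsub>?F\<^esub> p = Poly_Mapping.map ((*) c) p" for p q c
    by (simp_all add: free_nalg_def)
  have scale_right: "p * Poly_Mapping.map ((*) c) q = Poly_Mapping.map ((*) c) (p * q)"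
    for c and p q :: "nat word \<Rightarrow>\<^sub>0 'k"
    unfolding scale_eq_single_mult mult.assoc [symmetric] mult_single_zero_commute [of p c] ..
  have scale_left: "Poly_Mapping.map ((*) c) p * q = Poly_Mapping.map ((*) c) (p * q)"
    for c and p q :: "nat word \<Rightarrow>\<^sub>0 'k"
    by (simp add: scale_eq_single_mult mult.assoc)
  have scale_space:
    "Poly_Mapping.map ((*) (c + d)) p
      = Poly_Mapping.map ((*) c) p + Poly_Mapping.map ((*) d) p"
    "Poly_Mapping.map ((*) c) (p + q)
      = Poly_Mapping.map ((*) c) p + Poly_Mapping.map ((*) c) q"
    "Poly_Mapping.map ((*) (c * d)) p = Poly_Mapping.map ((*) c) (Poly_Mapping.map ((*) d) p)"
    "Poly_Mapping.map ((*) 1) p = p"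
    for c d and p q :: "nat word \<Rightarrow>\<^sub>0 'k"
    by (rule poly_mapping_eqI, simp add: lookup_scale lookup_add algebra_simps)+
  have "abelian_group ?F"
  proof (rule abelian_groupI)
    show "\<exists>q\<in>carrier ?F. q \<oplus>\<^bsub>?F\<^esub> p = \<zero>\<^bsub>?F\<^esub>" if "p \<in> carrier ?F" for p
      using neg [OF that] by (intro bexI [of _ "- p"]) (simp_all add: ops)
  qed (simp_all only: ops add zero ac_simps add_0 add_0_right)
  then show ?thesis
    by (rule nonunital_algebra.intro, unfold_locales)
      (simp_all only: ops mult scale scale_left scale_right scale_space
        mult.assoc distrib_left distrib_right)
qed

lemma (in nonunital_algebra) s_zero: "x \<in> carrier A \<Longrightarrow> 0 \<odot> x = \<zero>"
  using s_ldistr [of x 0 0] s_closed [of x 0] by (metis add.r_cancel_one' add_0)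

lemma (in nonunital_algebra) s_minus_one: "x \<in> carrier A \<Longrightarrow> (- 1) \<odot> x = \<ominus> x"
  using s_ldistr [of x "- 1" 1] s_zero [of x] s_one [of x] s_closed [of x "- 1"]
  by (simp add: minus_equality)

lemma (in nonunital_algebra) m_zero:
  assumes "x \<in> carrier A" shows "x \<otimes> \<zero> = \<zero>" "\<zero> \<otimes> x = \<zero>"
  using s_left [of \<zero> x 0] s_right [of x \<zero> 0] assms m_closed s_zero by auto

lemma (in nonunital_algebra) s_zero_right: "c \<odot> \<zero> = \<zero>"
  using s_rdistr [of \<zero> \<zero> c] s_closed [of \<zero> c] by (metis add.r_cancel_one' r_zero zero_closed)

lemma nalg_ideal_genideal:
  assumes "nonunital_algebra A" "S \<subseteq> carrier A"
  shows "nalg_ideal A (nalg_genideal A S)"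
proof -
  interpret nonunital_algebra A by fact
  have "nalg_ideal A (carrier A)"
    by (simp add: nalg_ideal_def m_closed s_closed)
  then have "nalg_genideal A S \<subseteq> carrier A"
    using assms(2) by (auto simp: nalg_genideal_def)
  then show ?thesis
    by (auto simp: nalg_ideal_def nalg_genideal_def)
qed

lemma nalg_quot_nonunital_algebra:
  assumes "nonunital_algebra A" "nalg_ideal A I"
  shows "nonunital_algebra (nalg_quot A I)"
proof -
  interpret nonunital_algebra A by fact
  have I: "I \<subseteq> carrier A" "\<zero>\<^bsub>A\<^esub> \<in> I" "\<And>x y. x \<in> I \<Longrightarrow> y \<in> I \<Longrightarrow> x \<oplus>\<^bsub>A\<^esub> y \<in> I"
    "\<And>x c. x \<in> I \<Longrightarrow> c \<odot>\<^bsub>A\<^esub> x \<in> I"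
    "\<And>a x. a \<in> carrier A \<Longrightarrow> x \<in> I \<Longrightarrow> a \<otimes>\<^bsub>A\<^esub> x \<in> I"
    "\<And>a x. a \<in> carrier A \<Longrightarrow> x \<in> I \<Longrightarrow> x \<otimes>\<^bsub>A\<^esub> a \<in> I"
    using assms(2) by (auto simp: nalg_ideal_def)
  have "subgroup I (add_monoid A)"
    using I by (auto intro!: add.subgroupI simp flip: a_inv_def s_minus_one)
  then interpret S: abelian_subgroup I A
    by (intro abelian_subgroupI3 additive_subgroupI abelian_group_axioms)
  have sub: "subgroup I (add_monoid A)" by (rule S.a_subgroup)
  let ?Q = "nalg_quot A I" and ?r = "\<lambda>x. I +>\<^bsub>A\<^esub> x"
  have cos: "?r (i \<oplus>\<^bsub>A\<^esub> x) = ?r x" if "i \<in> I" "x \<in> carrier A" for i x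
    using that a_repr_independence [OF _ _ sub, of "i \<oplus>\<^bsub>A\<^esub> x" x] a_rcosI [of i I x] I(1) by simp
  have elem: "y \<in> ?r x \<longleftrightarrow> (\<exists>i\<in>I. y = i \<oplus>\<^bsub>A\<^esub> x)" for x y
    by (auto simp: a_r_coset_def')
  have car: "carrier ?Q = ?r ` carrier A"
    by (auto simp: nalg_quot_def A_RCOSETS_def')
  have add: "?r x \<oplus>\<^bsub>?Q\<^esub> ?r y = ?r (x \<oplus>\<^bsub>A\<^esub> y)" if "x \<in> carrier A" "y \<in> carrier A" for x y
    using that S.a_rcos_sum by (simp add: nalg_quot_def)
  have zero: "\<zero>\<^bsub>?Q\<^esub> = ?r \<zero>\<^bsub>A\<^esub>"
    using I(1) by (simp add: nalg_quot_def)
  have smult: "c \<odot>\<^bsub>?Q\<^esub> ?r x = ?r (c \<odot>\<^bsub>A\<^esub> x)" if x: "x \<in> carrier A" for c x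
  proof -
    have "?r (c \<odot>\<^bsub>A\<^esub> y) = ?r (c \<odot>\<^bsub>A\<^esub> x)" if y: "y \<in> ?r x" for y
    proof -
      obtain i where "i \<in> I" "y = i \<oplus>\<^bsub>A\<^esub> x" using y elem by auto
      then have "c \<odot>\<^bsub>A\<^esub> y = c \<odot>\<^bsub>A\<^esub> i \<oplus>\<^bsub>A\<^esub> c \<odot>\<^bsub>A\<^esub> x"
        using x I(1) s_rdistr [of i x c] by blast
      then show ?thesis
        using cos [OF I(4) [OF \<open>i \<in> I\<close>] s_closed [OF x]] by metis
    qed
    then have "(\<Union>y\<in>?r x. ?r (c \<odot>\<^bsub>A\<^esub> y)) = ?r (c \<odot>\<^bsub>A\<^esub> x)"
      using S.a_rcos_self [OF x] by blast
    then show ?thesis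
      by (simp add: nalg_quot_def)
  qed
  have mult: "?r x \<otimes>\<^bsub>?Q\<^esub> ?r y = ?r (x \<otimes>\<^bsub>A\<^esub> y)"
    if x: "x \<in> carrier A" and y: "y \<in> carrier A" for x y
  proof -
    have "?r (x' \<otimes>\<^bsub>A\<^esub> y') = ?r (x \<otimes>\<^bsub>A\<^esub> y)" if x': "x' \<in> ?r x" and y': "y' \<in> ?r y" for x' y'
    proof -
      obtain i j where i: "i \<in> I" "x' = i \<oplus>\<^bsub>A\<^esub> x" and j: "j \<in> I" "y' = j \<oplus>\<^bsub>A\<^esub> y"
        using x' y' elem by auto
      have c: "i \<in> carrier A" "j \<in> carrier A" using i(1) j(1) I(1) by auto
      have "x' \<otimes>\<^bsub>A\<^esub> y' = i \<otimes>\<^bsub>A\<^esub> y' \<oplus>\<^bsub>A\<^esub> (x \<otimes>\<^bsub>A\<^esub> j \<oplus>\<^bsub>A\<^esub> x \<otimes>\<^bsub>A\<^esub> y)"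
        using c x y by (simp add: i(2) j(2) m_ldistr m_rdistr m_closed a_ac)
      moreover have "i \<otimes>\<^bsub>A\<^esub> y' \<in> I" "x \<otimes>\<^bsub>A\<^esub> j \<in> I"
        using c x y i(1) j I(5,6) by simp_all
      moreover have "x \<otimes>\<^bsub>A\<^esub> y \<in> carrier A" "x \<otimes>\<^bsub>A\<^esub> j \<in> carrier A"
        using c x y m_closed by simp_all
      ultimately show ?thesis
        using cos by simp
    qed
    then have "(\<Union>x'\<in>?r x. \<Union>y'\<in>?r y. ?r (x' \<otimes>\<^bsub>A\<^esub> y')) = ?r (x \<otimes>\<^bsub>A\<^esub> y)"
      using S.a_rcos_self [OF x] S.a_rcos_self [OF y] by blast
    then show ?thesis
      by (simp add: nalg_quot_def rcoset_mult_def)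
  qed
  have "abelian_group ?Q"
  proof (rule abelian_groupI)
    show "\<exists>Y\<in>carrier ?Q. Y \<oplus>\<^bsub>?Q\<^esub> X = \<zero>\<^bsub>?Q\<^esub>" if X: "X \<in> carrier ?Q" for X
    proof -
      obtain x where x: "x \<in> carrier A" "X = ?r x" using X car by auto
      then show ?thesis
        by (intro bexI [of _ "?r (\<ominus>\<^bsub>A\<^esub> x)"]) (auto simp: add zero car l_neg)
    qed
  qed (auto simp: car add zero a_ac)
  then show ?thesis
    unfolding nonunital_algebra_def nonunital_algebra_axioms_def
    by (auto simp: car add mult smult m_closed s_closed m_assoc m_ldistr m_rdistr
        s_ldistr s_rdistr s_assoc s_one s_left s_right)
qed

end

theory Submission
  imports Defs "Jordan_Normal_Form.Determinant"
begin

text \<open>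
  Lift the generators \<open>g\<^sub>i\<close> to polynomials \<open>G\<^sub>i\<close> in the \<open>n + k\<close> variables. Modulo terms of degree at
  least two, the \<open>n + k\<close> polynomials \<open>G\<^sub>i\<close>, \<open>h\<^sub>j\<close> span the linear forms, so their linear parts form a
  basis. By the inverse function theorem for noncommutative power series, there is a substitution \<open>X\<close>
  with \<open>G\<^sub>i(X) = z\<^sub>i\<close> and \<open>h\<^sub>j(X) = 0\<close>. A relation \<open>\<Phi>(g) = 0\<close> in \<open>A\<close> means that \<open>\<Phi>(G)\<close> lies in the
  ideal generated by the \<open>h\<^sub>j\<close>; substituting \<open>X\<close> yields \<open>\<Phi> = 0\<close>.
\<close>


section \<open>Substitution into noncommutative polynomials\<close>

lemma poly_mapping_sum_singles:
  fixes p :: "'a \<Rightarrow>\<^sub>0 'b::comm_monoid_add"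
  shows "(\<Sum>w\<in>Poly_Mapping.keys p. Poly_Mapping.single w (Poly_Mapping.lookup p w)) = p"
  by (rule poly_mapping_eqI) (simp add: lookup_sum lookup_single when_def in_keys_iff)

lemma single_sum: "Poly_Mapping.single w (\<Sum>i\<in>S. f i) = (\<Sum>i\<in>S. Poly_Mapping.single w (f i))"
  by (induction S rule: infinite_finite_induct) (simp_all add: single_add)

text \<open>A scalar \<open>c\<close> is encoded as \<open>Poly_Mapping.single 0 c\<close>, a
  multiple of the empty word, so the sum is formed in the unital ring of all noncommutative
  polynomials and the empty word receives the value \<open>1\<close>. Substitution is then
  multiplicative on the whole type, with no carrier conditions.\<close>

definition subst :: "('x \<Rightarrow> ('y word \<Rightarrow>\<^sub>0 'k)) \<Rightarrow> ('x word \<Rightarrow>\<^sub>0 'k) \<Rightarrow> ('y word \<Rightarrow>\<^sub>0 'k::field)" where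
  "subst X p = (\<Sum>w\<in>Poly_Mapping.keys p.
     Poly_Mapping.single 0 (Poly_Mapping.lookup p w) * prod_list (map X (letters w)))"

lemma subst_superset:
  assumes "finite S" "Poly_Mapping.keys p \<subseteq> S"
  shows "subst X p = (\<Sum>w\<in>S.
     Poly_Mapping.single 0 (Poly_Mapping.lookup p w) * prod_list (map X (letters w)))"
  unfolding subst_def using assms by (intro sum.mono_neutral_left) (auto simp: in_keys_iff)

lemma subst_single:
  "subst X (Poly_Mapping.single w c) = Poly_Mapping.single 0 c * prod_list (map X (letters w))"
  by (subst subst_superset [of "{w}"]) auto

lemma subst_zero [simp]: "subst X 0 = 0"
  by (simp add: subst_def)

lemma subst_add: "subst X (p + q) = subst X p + subst X q"
proof -
  let ?S = "Poly_Mapping.keys p \<union> Poly_Mapping.keys q"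
  have "Poly_Mapping.keys (p + q) \<subseteq> ?S"
    by (rule Poly_Mapping.keys_add)
  then show ?thesis
    by (simp add: subst_superset [of ?S] lookup_add single_add distrib_right sum.distrib)
qed

lemma subst_sum: "subst X (\<Sum>i\<in>S. f i) = (\<Sum>i\<in>S. subst X (f i))"
  by (induction S rule: infinite_finite_induct) (simp_all add: subst_add)

lemma subst_diff: "subst X (p - q) = subst X p - subst X q"
  using subst_add [of X "p - q" q] by simp

text \<open>Both sides are additive in each factor, so single terms suffice. For these, the scalar
  of the second factor has to move past the product substituted for the first word, which works
  because scalars are central.\<close>

lemma subst_mult: "subst X (p * q) = subst X p * subst X q"
proof -
  let ?s = Poly_Mapping.single
  have *: "subst X (?s u a * ?s v b) = subst X (?s u a) * subst X (?s v b)" for u v a b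
  proof -
    have "?s 0 (a * b) * (prod_list (map X (letters u)) * P)
      = ?s 0 a * prod_list (map X (letters u)) * (?s 0 b * P)" for P
      using mult_single_zero_commute [of "prod_list (map X (letters u))" b]
      by (simp add: mult_single [of 0 a 0 b, simplified, symmetric] mult.assoc)
        (simp flip: mult.assoc)
    then show ?thesis
      by (simp add: mult_single subst_single)
  qed
  have "subst X ((\<Sum>u\<in>Poly_Mapping.keys p. ?s u (Poly_Mapping.lookup p u)) *
      (\<Sum>v\<in>Poly_Mapping.keys q. ?s v (Poly_Mapping.lookup q v)))
    = subst X (\<Sum>u\<in>Poly_Mapping.keys p. ?s u (Poly_Mapping.lookup p u)) *
      subst X (\<Sum>v\<in>Poly_Mapping.keys q. ?s v (Poly_Mapping.lookup q v))"
    by (simp only: sum_product subst_sum *)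
  then show ?thesis
    by (simp only: poly_mapping_sum_singles)
qed

lemma subst_scale: "subst X (Poly_Mapping.map ((*) c) p) = Poly_Mapping.map ((*) c) (subst X p)"
  by (simp add: scale_eq_single_mult subst_mult subst_single)

lemma subst_prod_list: "subst X (prod_list ps) = prod_list (map (subst X) ps)"
  by (induction ps) (simp_all add: subst_mult subst_single [of X 0 1, simplified])

lemma subst_subst: "subst X (subst Y p) = subst (\<lambda>i. subst X (Y i)) p"
  by (simp add: subst_def [of Y] subst_def [of "\<lambda>i. subst X (Y i)"] subst_sum subst_mult
      subst_single subst_prod_list comp_def)

definition var :: "'x \<Rightarrow> ('x word \<Rightarrow>\<^sub>0 'k::field)" where
  "var i = Poly_Mapping.single (Word [i]) 1"

lemma subst_var: "subst X (var i) = X i"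
  by (simp add: var_def subst_single)

lemma prod_list_var: "prod_list (map var xs) = Poly_Mapping.single (Word xs) 1"
proof (induction xs)
  case Nil
  show ?case by (simp flip: zero_word_def)
next
  case (Cons x xs)
  then show ?case by (simp add: var_def mult_single plus_word_def)
qed

lemma subst_identity: "subst var p = p"
  by (simp add: subst_def prod_list_var mult_single poly_mapping_sum_singles)


section \<open>The filtration by degree\<close>

text \<open>The \<open>d\<close>-th power of the augmentation ideal. Congruence modulo it means
  equal coefficients in all degrees below \<open>d\<close>, which takes the place of convergence of
  power series.\<close>

definition order_ge :: "nat \<Rightarrow> ('x word \<Rightarrow>\<^sub>0 'k::field) set" where
  "order_ge d = {p. \<forall>w\<in>Poly_Mapping.keys p. d \<le> length (letters w)}"

lemma order_ge_zero [simp]: "0 \<in> order_ge d"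
  by (simp add: order_ge_def)

lemma order_ge_0 [simp]: "p \<in> order_ge 0"
  by (simp add: order_ge_def)

lemma order_ge_mono: "p \<in> order_ge d \<Longrightarrow> e \<le> d \<Longrightarrow> p \<in> order_ge e"
  by (fastforce simp: order_ge_def)

lemma order_ge_add: "p \<in> order_ge d \<Longrightarrow> q \<in> order_ge d \<Longrightarrow> p + q \<in> order_ge d"
  using Poly_Mapping.keys_add [of p q] by (fastforce simp: order_ge_def)

lemma order_ge_uminus: "p \<in> order_ge d \<Longrightarrow> - p \<in> order_ge d"
  by (simp add: order_ge_def)

lemma order_ge_diff: "p \<in> order_ge d \<Longrightarrow> q \<in> order_ge d \<Longrightarrow> p - q \<in> order_ge d"
  using order_ge_add [of p d "- q"] order_ge_uminus by force

lemma order_ge_sum: "(\<And>i. i \<in> S \<Longrightarrow> f i \<in> order_ge d) \<Longrightarrow> (\<Sum>i\<in>S. f i) \<in> order_ge d"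
  by (induction S rule: infinite_finite_induct) (auto intro: order_ge_add)

lemma order_ge_mult: "p \<in> order_ge d \<Longrightarrow> q \<in> order_ge e \<Longrightarrow> p * q \<in> order_ge (d + e)"
  using keys_mult [of p q] by (fastforce simp: order_ge_def intro: add_mono)

lemma order_ge_scalar_mult: "p \<in> order_ge d \<Longrightarrow> Poly_Mapping.single 0 c * p \<in> order_ge d"
  using order_ge_mult [of "Poly_Mapping.single 0 c" 0 p d] by simp

lemma order_ge_mult_absorb:
  "p \<in> order_ge d \<Longrightarrow> q * p \<in> order_ge d" "p \<in> order_ge d \<Longrightarrow> p * q \<in> order_ge d"
  using order_ge_mult [of q 0 p d] order_ge_mult [of p d q 0] by simp_all

lemma lookup_order_ge:
  "p \<in> order_ge d \<Longrightarrow> length (letters w) < d \<Longrightarrow> Poly_Mapping.lookup p w = 0"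
  unfolding order_ge_def by (auto simp: in_keys_iff simp flip: not_le)

text \<open>The filtration is separated: the coefficient of \<open>w\<close> vanishes because the
  order exceeds the length of \<open>w\<close>. This turns approximate identities, valid to every
  order, into an exact one.\<close>

lemma order_ge_all_imp_zero:
  assumes "\<And>d. p \<in> order_ge d"
  shows "p = 0"
  by (rule poly_mapping_eqI) (simp add: lookup_order_ge [OF assms lessI])

lemma prod_list_order_ge:
  "(\<And>i. i \<in> set xs \<Longrightarrow> X i \<in> order_ge 1) \<Longrightarrow> prod_list (map X xs) \<in> order_ge (length xs)"
proof (induction xs)
  case (Cons x xs)
  then show ?case using order_ge_mult [of "X x" 1 "prod_list (map X xs)" "length xs"] by simp
qed simp

lemma subst_order_ge:
  assumes "\<And>i. X i \<in> order_ge 1" "p \<in> order_ge d"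
  shows "subst X p \<in> order_ge d"
  unfolding subst_def
proof (intro order_ge_sum order_ge_scalar_mult)
  fix w assume "w \<in> Poly_Mapping.keys p"
  with assms show "prod_list (map X (letters w)) \<in> order_ge d"
    by (intro order_ge_mono [OF prod_list_order_ge]) (auto simp: order_ge_def)
qed

text \<open>Telescoping: exchange one factor at a time. The exchanged factor contributes order
  \<open>d\<close>, and each of the other \<open>length xs - 1\<close> factors contributes at least
  1.\<close>

lemma prod_list_cong_order:
  assumes X: "\<And>i. X i \<in> order_ge 1" and Y: "\<And>i. Y i \<in> order_ge 1"
    and XY: "\<And>i. X i - Y i \<in> order_ge d"
  shows "xs \<noteq> [] \<Longrightarrow> prod_list (map X xs) - prod_list (map Y xs) \<in> order_ge (d + (length xs - 1))"
proof (induction xs)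
  case (Cons x xs)
  let ?P = "prod_list (map X xs)" and ?Q = "prod_list (map Y xs)"
  have eq: "X x * ?P - Y x * ?Q = (X x - Y x) * ?P + Y x * (?P - ?Q)"
    by (simp add: algebra_simps)
  have "(X x - Y x) * ?P \<in> order_ge (d + length xs)"
    using X XY by (intro order_ge_mult prod_list_order_ge)
  moreover have "Y x * (?P - ?Q) \<in> order_ge (d + length xs)"
  \<comment> \<open>For an empty tail both products are \<open>1\<close> and the difference
    vanishes; the induction hypothesis covers only a non-empty tail.\<close>
  proof (cases "xs = []")
    case False
    then have "Y x * (?P - ?Q) \<in> order_ge (1 + (d + (length xs - 1)))"
      using Cons.IH Y by (intro order_ge_mult) auto
    with False show ?thesis by (cases xs) auto
  qed simp
  ultimately show ?case
    by (simp add: eq order_ge_add)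
qed simp

text \<open>The gain of \<open>e\<close> in order is what makes the iteration in \<open>approximate_inverse\<close> converge.\<close>

lemma subst_cong_order:
  assumes "\<And>i. X i \<in> order_ge 1" "\<And>i. Y i \<in> order_ge 1" "\<And>i. X i - Y i \<in> order_ge d"
    and p: "p \<in> order_ge (Suc e)"
  shows "subst X p - subst Y p \<in> order_ge (d + e)"
proof -
  have "prod_list (map X (letters w)) - prod_list (map Y (letters w)) \<in> order_ge (d + e)"
    if "w \<in> Poly_Mapping.keys p" for w
    using that p
    by (intro order_ge_mono [OF prod_list_cong_order [OF assms(1-3)]]) (auto simp: order_ge_def)
  then show ?thesis
    unfolding subst_def sum_subtractf [symmetric] right_diff_distrib [symmetric]
    by (intro order_ge_sum order_ge_scalar_mult)
qed


section \<open>Linear parts\<close>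

lemma carrier_free_nalg_iff:
  "p \<in> carrier (free_nalg m) \<longleftrightarrow>
     (\<forall>w\<in>Poly_Mapping.keys p. letters w \<noteq> [] \<and> set (letters w) \<subseteq> {..<m})"
  by (simp add: free_nalg_def)

lemma free_nalg_ops [simp]:
  "p \<otimes>\<^bsub>free_nalg m\<^esub> q = p * q" "p \<oplus>\<^bsub>free_nalg m\<^esub> q = p + q" "\<zero>\<^bsub>free_nalg m\<^esub> = 0"
  "c \<odot>\<^bsub>free_nalg m\<^esub> p = Poly_Mapping.map ((*) c) p"
  by (simp_all add: free_nalg_def)

lemma carrier_free_nalg_order: "p \<in> carrier (free_nalg m) \<Longrightarrow> p \<in> order_ge 1"
  by (auto simp: carrier_free_nalg_iff order_ge_def Suc_le_eq)

abbreviation coeff1 :: "('x word \<Rightarrow>\<^sub>0 'k::field) \<Rightarrow> 'x \<Rightarrow> 'k" where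
  "coeff1 p i \<equiv> Poly_Mapping.lookup p (Word [i])"

definition linear_part :: "nat \<Rightarrow> (nat word \<Rightarrow>\<^sub>0 'k) \<Rightarrow> (nat word \<Rightarrow>\<^sub>0 'k::field)" where
  "linear_part m p = (\<Sum>i<m. Poly_Mapping.single 0 (coeff1 p i) * var i)"

lemma coeff1_scalar_mult: "coeff1 (Poly_Mapping.single 0 c * p) i = c * coeff1 p i"
  by (simp flip: scale_eq_single_mult add: lookup_scale)

lemma coeff1_var: "coeff1 (var i) j = (if i = j then 1 else 0)"
  by (simp add: var_def lookup_single when_def)

lemma coeff1_linear_part: "coeff1 (linear_part m p) i = (if i < m then coeff1 p i else 0)"
  by (simp add: linear_part_def lookup_sum coeff1_scalar_mult coeff1_var if_distrib sum.delta'
      cong: if_cong)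

text \<open>Membership in the carrier excludes a constant term and all variables of index
  \<open>m\<close> or more, so the first \<open>m\<close> linear terms are everything in degree
  below two.\<close>

lemma diff_linear_part_order:
  assumes "p \<in> carrier (free_nalg m)"
  shows "p - linear_part m p \<in> order_ge 2"
  unfolding order_ge_def
proof safe
  fix w assume w: "w \<in> Poly_Mapping.keys (p - linear_part m p)"
  have "linear_part m p \<in> order_ge 1"
    unfolding linear_part_def
    by (intro order_ge_sum order_ge_scalar_mult) (simp add: order_ge_def var_def)
  then have "p - linear_part m p \<in> order_ge 1"
    using carrier_free_nalg_order [OF assms] by (rule order_ge_diff [rotated])
  then have "1 \<le> length (letters w)" using w by (simp add: order_ge_def)
  moreover have "length (letters w) \<noteq> 1"
  proof
    assume "length (letters w) = 1"
    then obtain i where i: "w = Word [i]"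
      by (cases w) (auto simp: length_Suc_conv)
    have "coeff1 p i = 0" if "\<not> i < m"
      using that assms by (force simp: carrier_free_nalg_iff in_keys_iff)
    then show False
      using w by (auto simp: i in_keys_iff lookup_minus coeff1_linear_part split: if_splits)
  qed
  ultimately show "2 \<le> length (letters w)" by simp
qed

lemma subst_linear_part:
  "subst X (linear_part m p) = (\<Sum>i<m. Poly_Mapping.single 0 (coeff1 p i) * X i)"
  by (simp add: linear_part_def subst_sum subst_mult subst_var subst_single)

lemma subst_diff_linear_part_order:
  assumes "p \<in> carrier (free_nalg m)" "\<And>i. X i \<in> order_ge 1"
  shows "subst X p - (\<Sum>i<m. Poly_Mapping.single 0 (coeff1 p i) * X i) \<in> order_ge 2"
  using subst_order_ge [OF assms(2) diff_linear_part_order [OF assms(1)]]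
  by (simp add: subst_diff subst_linear_part)

text \<open>The chain rule at the origin: words of length at least two go to order at least two, so
  only the linear part of \<open>p\<close> reaches degree one.\<close>

lemma coeff1_subst:
  assumes "p \<in> carrier (free_nalg m)" "\<And>i. i < m \<Longrightarrow> X i \<in> order_ge 1"
  shows "coeff1 (subst X p) j = (\<Sum>i<m. coeff1 p i * coeff1 (X i) j)"
proof -
  \<comment> \<open>The order lemmas ask for a bound on every \<open>X i\<close>, while here it is
    known only for \<open>i < m\<close>; the other values do not occur in \<open>p\<close> and are
    reset to 0.\<close>
  define Y where "Y = (\<lambda>i. if i < m then X i else 0)"
  have "subst X p = subst Y p"
    unfolding subst_def
  proof (intro sum.cong refl arg_cong2 [where f = "(*)"] arg_cong [where f = prod_list] map_cong)
    fix w i assume "w \<in> Poly_Mapping.keys p" "i \<in> set (letters w)"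
    then have "i < m" using assms(1) unfolding carrier_free_nalg_iff by blast
    then show "X i = Y i" by (simp add: Y_def)
  qed
  moreover have "subst Y p - (\<Sum>i<m. Poly_Mapping.single 0 (coeff1 p i) * Y i) \<in> order_ge 2"
    using assms by (intro subst_diff_linear_part_order) (auto simp: Y_def)
  ultimately have "coeff1 (subst X p - (\<Sum>i<m. Poly_Mapping.single 0 (coeff1 p i) * Y i)) j = 0"
    by (intro lookup_order_ge [where d = 2]) auto
  then show ?thesis
    by (simp add: lookup_minus lookup_sum coeff1_scalar_mult Y_def)
qed

text \<open>Here the count of generators and relations enters: as many polynomials as variables give
  a square matrix, for which a one-sided inverse over a field is two-sided.\<close>

lemma square_left_inverse_imp_right_inverse:
  fixes C M :: "nat \<Rightarrow> nat \<Rightarrow> 'k::field"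
  assumes "\<And>i j. i < m \<Longrightarrow> j < m \<Longrightarrow> (\<Sum>l<m. C i l * M l j) = (if i = j then 1 else 0)"
    and "i < m" "j < m"
  shows "(\<Sum>l<m. M i l * C l j) = (if i = j then 1 else 0)"
proof -
  define MC where "MC = mat m m (\<lambda>(i, j). C i j)"
  define MM where "MM = mat m m (\<lambda>(i, j). M i j)"
  have "MC * MM = 1\<^sub>m m"
    by (rule eq_matI) (auto simp: MC_def MM_def scalar_prod_def assms(1) atLeast0LessThan)
  then have "MM * MC = 1\<^sub>m m"
    by (intro mat_mult_left_right_inverse [of MC m MM]) (simp_all add: MC_def MM_def)
  then have "(MM * MC) $$ (i, j) = 1\<^sub>m m $$ (i, j)" by simp
  then show ?thesis
    using assms(2,3) by (simp add: MC_def MM_def scalar_prod_def atLeast0LessThan)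
qed

text \<open>
  The inverse function theorem for noncommutative power series, truncated at degree \<open>d\<close> so as to
  stay within polynomials.
\<close>

lemma approximate_inverse:
  fixes P :: "nat \<Rightarrow> (nat word \<Rightarrow>\<^sub>0 'k::field)" and t :: "nat \<Rightarrow> (nat word \<Rightarrow>\<^sub>0 'k)"
  assumes P: "\<And>l. l < m \<Longrightarrow> P l \<in> carrier (free_nalg m)"
    and inv: "\<And>i j. i < m \<Longrightarrow> j < m \<Longrightarrow>
      (\<Sum>l<m. C i l * coeff1 (P l) j) = (if i = j then 1 else 0)"
    and t: "\<And>l. t l \<in> order_ge 1"
  shows "\<exists>X. (\<forall>i. X i \<in> order_ge 1) \<and> (\<forall>l<m. subst X (P l) - t l \<in> order_ge d)"
proof -
  let ?c = "\<lambda>a. Poly_Mapping.single 0 a :: nat word \<Rightarrow>\<^sub>0 'k"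
  define N where "N = (\<lambda>l. P l - linear_part m (P l))"
  have N: "N l \<in> order_ge 2" if "l < m" for l
    using diff_linear_part_order [OF P [OF that]] by (simp add: N_def)
  \<comment> \<open>With \<open>M\<close> the matrix of linear coefficients, the system to solve is
    \<open>M X + N(X) = t\<close>. Multiplying by the left inverse \<open>C\<close> gives the fixed
    point equation \<open>X = C (t - N(X))\<close>, which is iterated from 0.\<close>
  define step where "step = (\<lambda>X i. \<Sum>l<m. ?c (C i l) * (t l - subst X (N l)))"
  define X where "X = (\<lambda>e. (step ^^ e) (\<lambda>_. 0))"
  have X_Suc: "X (Suc e) = step (X e)" for e
    by (simp add: X_def)
  have X1: "X e i \<in> order_ge 1" for e i
  proof (induction e arbitrary: i)
    case (Suc e)
    have "subst (X e) (N l) \<in> order_ge 1" if "l < m" for l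
      using subst_order_ge [OF Suc N [OF that]] by (rule order_ge_mono) simp
    then show ?case
      unfolding X_Suc step_def
      by (intro order_ge_sum order_ge_scalar_mult order_ge_diff t) auto
  qed (simp add: X_def)
  \<comment> \<open>Each round gains one degree: \<open>N\<close> starts in degree two, so
    \<open>subst_cong_order\<close> applies with \<open>e = 1\<close>.\<close>
  have cauchy: "X (Suc e) i - X e i \<in> order_ge (Suc e)" for e i
  proof (induction e arbitrary: i)
    case 0
    show ?case using X1 [of "Suc 0" i] by (simp add: X_def)
  next
    case (Suc e)
    have "subst (X (Suc e)) (N l) - subst (X e) (N l) \<in> order_ge (Suc e + 1)" if "l < m" for l
      using N [OF that] by (intro subst_cong_order X1 Suc) (simp add: numeral_2_eq_2)
    then have "(\<Sum>l<m. ?c (C i l) * (subst (X e) (N l) - subst (X (Suc e)) (N l)))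
        \<in> order_ge (Suc (Suc e))"
      by (intro order_ge_sum order_ge_scalar_mult) (use order_ge_uminus in fastforce)
    moreover have "X (Suc (Suc e)) i - X (Suc e) i
      = (\<Sum>l<m. ?c (C i l) * (subst (X e) (N l) - subst (X (Suc e)) (N l)))"
      by (subst (1) X_Suc, subst (2) X_Suc)
        (simp add: step_def sum_subtractf [symmetric] right_diff_distrib [symmetric])
    ultimately show ?case by simp
  qed
  have "subst (X d) (P l) - t l \<in> order_ge d" if l: "l < m" for l
  proof -
    let ?M = "\<lambda>i. coeff1 (P l) i"
    \<comment> \<open>Now \<open>M C = 1\<close> is used: applying \<open>M\<close> to the iterate
      \<open>X (Suc d)\<close> returns \<open>t - N(X d)\<close>. The error of \<open>X d\<close> is
      therefore \<open>M\<close> applied to the difference of two consecutive iterates.\<close>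
    have "(\<Sum>i<m. ?c (?M i) * X (Suc d) i)
      = (\<Sum>i<m. \<Sum>j<m. ?c (?M i * C i j) * (t j - subst (X d) (N j)))"
      by (simp add: X_Suc step_def sum_distrib_left mult_single mult.assoc [symmetric])
    also have "\<dots> = (\<Sum>j<m. ?c (\<Sum>i<m. ?M i * C i j) * (t j - subst (X d) (N j)))"
      by (subst sum.swap) (simp add: single_sum sum_distrib_right)
    also have "\<dots> = (\<Sum>j<m. if j = l then t j - subst (X d) (N j) else 0)"
      using square_left_inverse_imp_right_inverse [OF inv l] by (intro sum.cong) auto
    also have "\<dots> = t l - subst (X d) (N l)"
      using l by simp
    finally have "subst (X d) (P l) - t l = (\<Sum>i<m. ?c (?M i) * (X d i - X (Suc d) i))"
      by (simp add: N_def subst_diff subst_linear_part right_diff_distrib sum_subtractf)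
    moreover have "X d i - X (Suc d) i \<in> order_ge d" for i
      using order_ge_uminus [OF order_ge_mono [OF cauchy [of d i], of d]] by simp
    ultimately show ?thesis
      by (simp add: order_ge_sum order_ge_scalar_mult)
  qed
  with X1 show ?thesis by blast
qed


section \<open>Evaluation in quotients of free algebras\<close>

lemma nalg_ideal_free_nalg_diff:
  assumes "nalg_ideal (free_nalg m) I" "p \<in> I" "q \<in> I"
  shows "p - q \<in> I"
proof -
  have "Poly_Mapping.map ((*) (- 1)) q = - q"
    by (rule poly_mapping_eqI) (simp add: lookup_scale)
  moreover have "Poly_Mapping.map ((*) (- 1)) q \<in> I"
    using assms by (auto simp: nalg_ideal_def)
  ultimately show ?thesis
    using assms by (force simp: nalg_ideal_def)
qed

lemma nalg_isomorphic_sym: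
  assumes "nonunital_algebra A" "nalg_isomorphic A B"
  shows "nalg_isomorphic B A"
proof -
  interpret nonunital_algebra A by fact
  obtain f where f: "f \<in> nalg_hom A B" and bij: "bij_betw f (carrier A) (carrier B)"
    using assms(2) by (auto simp: nalg_isomorphic_def)
  define r where "r = inv_into (carrier A) f"
  have r: "r y \<in> carrier A" "f (r y) = y" if "y \<in> carrier B" for y
    using bij that by (auto simp: r_def bij_betw_def inv_into_into f_inv_into_f)
  have rf: "r (f x) = x" if "x \<in> carrier A" for x
    using bij that by (simp add: r_def bij_betw_def)
  have "r (x \<oplus>\<^bsub>B\<^esub> y) = r x \<oplus>\<^bsub>A\<^esub> r y" "r (x \<otimes>\<^bsub>B\<^esub> y) = r x \<otimes>\<^bsub>A\<^esub> r y"
    "r (c \<odot>\<^bsub>B\<^esub> x) = c \<odot>\<^bsub>A\<^esub> r x"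
    if "x \<in> carrier B" "y \<in> carrier B" for x y c
    using f that r rf [of "r x \<oplus>\<^bsub>A\<^esub> r y"] rf [of "r x \<otimes>\<^bsub>A\<^esub> r y"]
      rf [of "c \<odot>\<^bsub>A\<^esub> r x"]
    by (simp_all add: nalg_hom_def m_closed s_closed)
  then have "r \<in> nalg_hom B A"
    using r by (auto simp: nalg_hom_def)
  moreover have "bij_betw r (carrier B) (carrier A)"
    using bij by (simp add: r_def bij_betw_inv_into)
  ultimately show ?thesis
    by (auto simp: nalg_isomorphic_def)
qed

lemma subst_closed:
  assumes "p \<in> carrier (free_nalg n)" "\<And>i. i < n \<Longrightarrow> X i \<in> carrier (free_nalg m)"
  shows "subst X p \<in> carrier (free_nalg m)"
proof -
  interpret F: nonunital_algebra "free_nalg m"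
    by (rule free_nalg_nonunital_algebra)
  \<comment> \<open>Non-empty words matter: the empty product is \<open>1\<close>, a constant term
    outside the carrier.\<close>
  have prod: "prod_list (map X xs) \<in> carrier (free_nalg m)" if "xs \<noteq> []" "set xs \<subseteq> {..<n}" for xs
    using that
  proof (induction xs rule: list_nonempty_induct)
    case (cons x xs)
    then show ?case using F.m_closed [of "X x" "prod_list (map X xs)"] assms(2) by simp
  qed (use assms(2) in simp)
  have "(\<Sum>w\<in>S. Poly_Mapping.single 0 (Poly_Mapping.lookup p w) * prod_list (map X (letters w)))
      \<in> carrier (free_nalg m)" if "finite S" "S \<subseteq> Poly_Mapping.keys p" for S
    using that
  proof (induction S rule: finite_induct)
    case empty
    show ?case using F.zero_closed by simp
  next
    case (insert w S)
    then have "prod_list (map X (letters w)) \<in> carrier (free_nalg m)"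
      using assms(1) by (intro prod) (auto simp: carrier_free_nalg_iff)
    from F.s_closed [OF this, of "Poly_Mapping.lookup p w"] show ?case
      using insert F.a_closed by (simp add: scale_eq_single_mult)
  qed
  then show ?thesis by (simp add: subst_def)
qed

text \<open>Evaluating at images under \<open>f\<close> is the image of a substitution. This
  translates generation of \<open>A\<close>, phrased through \<open>nalg_eval\<close>, into
  surjectivity of a homomorphism.\<close>

lemma nalg_eval_hom:
  assumes "nonunital_algebra A" and f: "f \<in> nalg_hom (free_nalg m) A"
    and p: "p \<in> carrier (free_nalg n)"
    and X: "\<And>i. i < n \<Longrightarrow> X i \<in> carrier (free_nalg m)"
    and g: "\<And>i. i < n \<Longrightarrow> g i = f (X i)"
  shows "nalg_eval A g p = f (subst X p)"
proof -
  interpret A: nonunital_algebra A by fact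
  interpret F: nonunital_algebra "free_nalg m"
    by (rule free_nalg_nonunital_algebra)
  let ?F = "carrier (free_nalg m)"
  have closed: "f x \<in> carrier A" if "x \<in> ?F" for x
    using f that by (auto simp: nalg_hom_def)
  have add: "f (x + y) = f x \<oplus>\<^bsub>A\<^esub> f y" and mult: "f (x * y) = f x \<otimes>\<^bsub>A\<^esub> f y"
    and smult: "f (Poly_Mapping.single 0 c * x) = c \<odot>\<^bsub>A\<^esub> f x"
    if "x \<in> ?F" "y \<in> ?F" for x y c
    using f that by (auto simp: nalg_hom_def scale_eq_single_mult)
  have zero: "f 0 = \<zero>\<^bsub>A\<^esub>"
    using smult [of 0 0 0] closed [of 0] A.s_zero F.zero_closed by auto
  have word: "prod_list (map X xs) \<in> ?F \<and> word_eval A g xs = f (prod_list (map X xs))"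
    if "xs \<noteq> []" "set xs \<subseteq> {..<n}" for xs
    using that
  proof (induction xs rule: list_nonempty_induct)
    case (cons x xs)
    then obtain y ys where "xs = y # ys" by (cases xs) auto
    with cons show ?case
      using F.m_closed [of "X x" "prod_list (map X xs)"] X g mult by simp
  qed (use X g in simp)
  \<comment> \<open>Membership of the partial sums is carried through the induction because
    \<open>f\<close> is additive only on the carrier.\<close>
  have "(\<Sum>w\<in>S. Poly_Mapping.single 0 (Poly_Mapping.lookup p w) * prod_list (map X (letters w))) \<in> ?F
      \<and> (\<Oplus>\<^bsub>A\<^esub>w\<in>S. Poly_Mapping.lookup p w \<odot>\<^bsub>A\<^esub> word_eval A g (letters w))
        = f (\<Sum>w\<in>S. Poly_Mapping.single 0 (Poly_Mapping.lookup p w) * prod_list (map X (letters w)))"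
    if "finite S" "S \<subseteq> Poly_Mapping.keys p" for S
    using that
  proof (induction S rule: finite_induct)
    case empty
    show ?case using F.zero_closed zero by simp
  next
    case (insert w S)
    have w: "prod_list (map X (letters v)) \<in> ?F
        \<and> word_eval A g (letters v) = f (prod_list (map X (letters v)))" if "v \<in> insert w S" for v
      using insert that p by (intro word) (auto simp: carrier_free_nalg_iff)
    have sw: "Poly_Mapping.single 0 (Poly_Mapping.lookup p w) * prod_list (map X (letters w)) \<in> ?F"
      using F.s_closed [of "prod_list (map X (letters w))" "Poly_Mapping.lookup p w"] w [of w]
      by (simp add: scale_eq_single_mult)
    show ?case
      using insert w sw F.a_closed closed
      by (subst A.finsum_insert) (auto simp: add smult A.s_closed)
  qed
  then show ?thesis
    by (simp add: nalg_eval_def subst_def)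
qed

lemma coset_free_nalg: "I +>\<^bsub>free_nalg m\<^esub> p = (\<lambda>i. i + p) ` I"
  by (auto simp: a_r_coset_def')

lemma coset_free_nalg_eq_iff:
  assumes I: "nalg_ideal (free_nalg m) I"
  shows "I +>\<^bsub>free_nalg m\<^esub> p = I +>\<^bsub>free_nalg m\<^esub> q \<longleftrightarrow> p - q \<in> I"
proof
  assume "I +>\<^bsub>free_nalg m\<^esub> p = I +>\<^bsub>free_nalg m\<^esub> q"
  moreover have "p \<in> I +>\<^bsub>free_nalg m\<^esub> p"
    using I by (force simp: coset_free_nalg nalg_ideal_def)
  ultimately show "p - q \<in> I"
    by (auto simp: coset_free_nalg)
next
  have sub: "I +>\<^bsub>free_nalg m\<^esub> p \<subseteq> I +>\<^bsub>free_nalg m\<^esub> q" if "p - q \<in> I" for p q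
  proof -
    have "i + p \<in> (\<lambda>i. i + q) ` I" if "i \<in> I" for i
      using I that \<open>p - q \<in> I\<close>
      by (intro image_eqI [of _ _ "i + (p - q)"]) (auto simp: nalg_ideal_def)
    then show ?thesis by (auto simp: coset_free_nalg)
  qed
  assume pq: "p - q \<in> I"
  moreover have "0 \<in> I" using I by (simp add: nalg_ideal_def)
  then have "q - p \<in> I"
    using nalg_ideal_free_nalg_diff [OF I _ pq, of 0] by simp
  ultimately show "I +>\<^bsub>free_nalg m\<^esub> p = I +>\<^bsub>free_nalg m\<^esub> q"
    using sub by blast
qed

text \<open>The product and scalar multiple of cosets are unions over representatives, so the point
  is that all representatives give the same coset.\<close>

lemma coset_map_hom:
  assumes I: "nalg_ideal (free_nalg m) I"
  shows "(\<lambda>p. I +>\<^bsub>free_nalg m\<^esub> p) \<in> nalg_hom (free_nalg m) (nalg_quot (free_nalg m) I)"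
proof -
  let ?F = "carrier (free_nalg m)" and ?r = "\<lambda>p. I +>\<^bsub>free_nalg m\<^esub> p"
  have I0: "0 \<in> I" and IF: "I \<subseteq> ?F" and Iadd: "\<And>x y. x \<in> I \<Longrightarrow> y \<in> I \<Longrightarrow> x + y \<in> I"
    and Ismult: "\<And>c x. x \<in> I \<Longrightarrow> Poly_Mapping.map ((*) c) x \<in> I"
    and Imult: "\<And>a x. a \<in> ?F \<Longrightarrow> x \<in> I \<Longrightarrow> a * x \<in> I \<and> x * a \<in> I"
    using I by (auto simp: nalg_ideal_def)
  have mem: "y \<in> ?r x \<longleftrightarrow> y - x \<in> I" for x y
    by (force simp: coset_free_nalg image_iff)
  have self: "x \<in> ?r x" for x
    using I0 by (simp add: mem)
  have add: "?r x <+>\<^bsub>free_nalg m\<^esub> ?r y = ?r (x + y)" for x y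
  proof -
    have "z \<in> ?r (x + y) \<Longrightarrow> \<exists>a\<in>?r x. \<exists>b\<in>?r y. z = a + b" for z
      by (intro bexI [of _ "z - y"] bexI [of _ y] self) (simp_all add: mem algebra_simps)
    moreover have "a + b \<in> ?r (x + y)" if "a \<in> ?r x" "b \<in> ?r y" for a b
      using Iadd [of "a - x" "b - y"] that by (simp add: mem algebra_simps)
    ultimately show ?thesis
      by (auto simp: set_add_def')
  qed
  have smult: "(\<Union>a\<in>?r x. ?r (Poly_Mapping.map ((*) c) a)) = ?r (Poly_Mapping.map ((*) c) x)" for c x
  proof -
    have "?r (Poly_Mapping.map ((*) c) a) = ?r (Poly_Mapping.map ((*) c) x)" if "a \<in> ?r x" for a
      using Ismult [of "a - x" c] that
      by (simp add: coset_free_nalg_eq_iff [OF I] mem scale_eq_single_mult right_diff_distrib)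
    then show ?thesis using self by blast
  qed
  have mult: "(\<Union>a\<in>?r x. \<Union>b\<in>?r y. ?r (a * b)) = ?r (x * y)" if x: "x \<in> ?F" and y: "y \<in> ?F" for x y
  proof -
    have "?r (a * b) = ?r (x * y)" if "a \<in> ?r x" "b \<in> ?r y" for a b
    proof -
      have d: "a - x \<in> I" "b - y \<in> I" using that by (simp_all add: mem)
      have "a * b - x * y = (a - x) * (b - y) + (a - x) * y + x * (b - y)"
        by (simp add: algebra_simps)
      moreover have "(a - x) * (b - y) + (a - x) * y + x * (b - y) \<in> I"
        using d x y IF by (intro Iadd) (auto simp: Imult)
      ultimately show ?thesis
        by (simp add: coset_free_nalg_eq_iff [OF I])
    qed
    then show ?thesis using self by blast
  qed
  show ?thesis
    by (auto simp: nalg_hom_def nalg_quot_def A_RCOSETS_def' rcoset_mult_def add smult mult)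
qed

lemma nalg_hom_comp_subst:
  assumes f: "f \<in> nalg_hom (free_nalg m) A"
    and X: "\<And>i. i < n \<Longrightarrow> X i \<in> carrier (free_nalg m)"
  shows "(\<lambda>p. f (subst X p)) \<in> nalg_hom (free_nalg n) A"
  using f subst_closed [OF _ X]
  by (auto simp: nalg_hom_def subst_add subst_mult subst_scale)


section \<open>The ideal of relations\<close>

lemma genideal_minimal:
  "nalg_ideal A J \<Longrightarrow> S \<subseteq> J \<Longrightarrow> nalg_genideal A S \<subseteq> J"
  by (auto simp: nalg_genideal_def)

text \<open>The polynomials sent to order at least \<open>d\<close> form an ideal, being the
  preimage of one. Thus relations that vanish only approximately suffice to control the whole
  ideal.\<close>

lemma genideal_subst_order:
  assumes h: "h ` {..<k} \<subseteq> carrier (free_nalg m)"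
    and X: "\<And>j. j < k \<Longrightarrow> subst X (h j) \<in> order_ge d"
    and p: "p \<in> nalg_genideal (free_nalg m) (h ` {..<k})"
  shows "subst X p \<in> order_ge d"
proof -
  interpret F: nonunital_algebra "free_nalg m"
    by (rule free_nalg_nonunital_algebra)
  let ?J = "{p \<in> carrier (free_nalg m). subst X p \<in> order_ge d}"
  have "nalg_ideal (free_nalg m) ?J"
    using F.a_closed F.m_closed F.s_closed F.zero_closed
    by (auto simp: nalg_ideal_def subst_add subst_mult order_ge_add order_ge_mult_absorb subst_scale)
      (simp_all add: scale_eq_single_mult order_ge_scalar_mult)
  moreover have "h ` {..<k} \<subseteq> ?J" using h X by auto
  ultimately have "p \<in> ?J" using genideal_minimal p by blast
  then show ?thesis by simp
qed

text \<open>A product of two polynomials without constant term has no linear part. In degree one the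
  ideal is therefore just the linear span of the relations.\<close>

lemma genideal_coeff1:
  fixes k :: nat
  assumes h: "h ` {..<k} \<subseteq> carrier (free_nalg m)"
    and p: "p \<in> nalg_genideal (free_nalg m) (h ` {..<k})"
  shows "\<exists>c. \<forall>i. coeff1 p i = (\<Sum>j<k. c j * coeff1 (h j) i)"
proof -
  interpret F: nonunital_algebra "free_nalg m"
    by (rule free_nalg_nonunital_algebra)
  define R where "R p \<longleftrightarrow> (\<exists>c. \<forall>i. coeff1 p i = (\<Sum>j<k. c j * coeff1 (h j) i))" for p
  let ?J = "{p \<in> carrier (free_nalg m). R p}"
  have zero: "R p" if "\<And>i. coeff1 p i = 0" for p
    unfolding R_def using that by (intro exI [of _ "\<lambda>_. 0"]) simp
  have add: "R (p + q)" if "R p" "R q" for p q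
  proof -
    from that obtain c d where "\<And>i. coeff1 p i = (\<Sum>j<k. c j * coeff1 (h j) i)"
      "\<And>i. coeff1 q i = (\<Sum>j<k. d j * coeff1 (h j) i)" unfolding R_def by blast
    then show ?thesis
      unfolding R_def
      by (intro exI [of _ "\<lambda>j. c j + d j"]) (simp add: lookup_add distrib_right sum.distrib)
  qed
  have smult: "R (Poly_Mapping.map ((*) a) p)" if "R p" for a p
  proof -
    from that obtain c where "\<And>i. coeff1 p i = (\<Sum>j<k. c j * coeff1 (h j) i)" unfolding R_def by blast
    then show ?thesis
      unfolding R_def
      by (intro exI [of _ "\<lambda>j. a * c j"]) (simp add: lookup_scale sum_distrib_left mult.assoc)
  qed
  have mult: "R (p * q)" if "p \<in> carrier (free_nalg m)" "q \<in> carrier (free_nalg m)" for p q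
    using order_ge_mult [OF that [THEN carrier_free_nalg_order]]
    by (intro zero lookup_order_ge [where d = 2]) (simp_all add: numeral_2_eq_2)
  have "nalg_ideal (free_nalg m) ?J"
    using F.a_closed F.m_closed F.s_closed F.zero_closed
    by (auto simp: nalg_ideal_def add smult mult zero)
  moreover have "R (h l)" if "l < k" for l
    unfolding R_def
  proof (intro exI [of _ "\<lambda>j. if j = l then 1 else 0"] allI)
    fix i
    have "(\<Sum>j<k. (if j = l then 1 else 0) * coeff1 (h j) i)
      = (\<Sum>j<k. if j = l then coeff1 (h j) i else 0)"
      by (intro sum.cong) auto
    then show "coeff1 (h l) i = (\<Sum>j<k. (if j = l then 1 else 0) * coeff1 (h j) i)"
      using that by simp
  qed
  then have "h ` {..<k} \<subseteq> ?J" using h by auto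
  ultimately have "p \<in> ?J" using genideal_minimal p by blast
  then show ?thesis by (simp add: R_def)
qed

lemma subst_in_genideal_imp_zero:
  fixes h G :: "nat \<Rightarrow> (nat word \<Rightarrow>\<^sub>0 'k::field)"
    and n k :: nat
  defines "I \<equiv> nalg_genideal (free_nalg (n + k)) (h ` {..<k})"
  assumes h: "\<And>j. j < k \<Longrightarrow> h j \<in> carrier (free_nalg (n + k))"
    and G: "\<And>i. i < n \<Longrightarrow> G i \<in> carrier (free_nalg (n + k))"
    and gen: "\<And>a. a < n + k \<Longrightarrow> \<exists>q\<in>carrier (free_nalg n). var a - subst G q \<in> I"
    and p: "p \<in> carrier (free_nalg n)" and pI: "subst G p \<in> I"
  shows "p = 0"
proof (rule order_ge_all_imp_zero)
  fix d
  have hF: "h ` {..<k} \<subseteq> carrier (free_nalg (n + k))" using h by auto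
  \<comment> \<open>The \<open>n\<close> lifted generators followed by the \<open>k\<close>
    relations, with the values \<open>t\<close> that the substitution should give them.\<close>
  define P where "P = (\<lambda>l. if l < n then G l else h (l - n))"
  define t where "t = (\<lambda>l. if l < n then var l else (0 :: nat word \<Rightarrow>\<^sub>0 'k))"
  have split: "(\<Sum>l<n + k. f l) = (\<Sum>l<n. f l) + (\<Sum>j<k. f (n + j))" for f :: "nat \<Rightarrow> 'k"
    by (induction k) (simp_all add: add.assoc)
  have "\<exists>c. \<forall>j<n + k. (\<Sum>l<n + k. c l * coeff1 (P l) j) = (if a = j then 1 else 0)"
    if "a < n + k" for a
  proof -
    obtain q where q: "q \<in> carrier (free_nalg n)" and "var a - subst G q \<in> I"
      using gen \<open>a < n + k\<close> by blast
    then obtain c where c: "\<And>i. coeff1 (var a - subst G q) i = (\<Sum>j<k. c j * coeff1 (h j) i)"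
      using genideal_coeff1 [OF hF] unfolding I_def by blast
    have G1: "coeff1 (subst G q) j = (\<Sum>i<n. coeff1 q i * coeff1 (G i) j)" for j
      using G by (intro coeff1_subst q carrier_free_nalg_order)
    \<comment> \<open>Row \<open>a\<close> of the left inverse: write \<open>var a\<close> as
      \<open>subst G q\<close> plus an element of \<open>I\<close> and compare linear coefficients,
      those of \<open>q\<close> weighting the generators and \<open>c\<close> the relations.\<close>
    have "(\<Sum>l<n + k. (if l < n then coeff1 q l else c (l - n)) * coeff1 (P l) j)
      = coeff1 (subst G q) j + coeff1 (var a - subst G q) j" for j
      by (simp only: c G1) (simp add: split P_def)
    then show ?thesis
      by (intro exI [of _ "\<lambda>l. if l < n then coeff1 q l else c (l - n)"])
        (simp add: lookup_minus coeff1_var)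
  qed
  then obtain C where C: "\<And>i j. i < n + k \<Longrightarrow> j < n + k \<Longrightarrow>
      (\<Sum>l<n + k. C i l * coeff1 (P l) j) = (if i = j then 1 else 0)"
    by metis
  have "\<exists>X. (\<forall>i. X i \<in> order_ge 1) \<and> (\<forall>l<n + k. subst X (P l) - t l \<in> order_ge d)"
    by (rule approximate_inverse [OF _ C]) (auto simp: P_def t_def h G order_ge_def var_def)
  then obtain X where X1: "\<And>i. X i \<in> order_ge 1"
    and X: "\<And>l. l < n + k \<Longrightarrow> subst X (P l) - t l \<in> order_ge d"
    by blast
  have "subst X (h j) \<in> order_ge d" if "j < k" for j
    using X [of "n + j"] that by (simp add: P_def t_def)
  then have vanish: "subst X (subst G p) \<in> order_ge d"
    using genideal_subst_order [OF hF] pI unfolding I_def by blast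
  \<comment> \<open>Only indices below \<open>n\<close> occur in \<open>p\<close>. Setting the
    others to \<open>var i\<close> makes \<open>Y\<close> agree with \<open>var\<close> to order
    \<open>d\<close> at every index.\<close>
  define Y where "Y = (\<lambda>i. if i < n then subst X (G i) else var i)"
  have "subst X (subst G p) = subst Y p"
    unfolding subst_subst unfolding subst_def [of _ p]
  proof (intro sum.cong refl arg_cong2 [where f = "(*)"] arg_cong [where f = prod_list] map_cong)
    fix w i assume "w \<in> Poly_Mapping.keys p" "i \<in> set (letters w)"
    then have "i < n" using p unfolding carrier_free_nalg_iff by blast
    then show "subst X (G i) = Y i" by (simp add: Y_def)
  qed
  moreover have "subst Y p - subst var p \<in> order_ge (d + 0)"
  proof (rule subst_cong_order)
    show "Y i \<in> order_ge 1" for i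
      using subst_order_ge [OF X1 carrier_free_nalg_order [OF G]]
      by (auto simp: Y_def order_ge_def var_def)
    show "Y i - var i \<in> order_ge d" for i
      using X [of i] by (auto simp: Y_def P_def t_def)
  qed (use carrier_free_nalg_order [OF p] in \<open>auto simp: order_ge_def var_def\<close>)
  ultimately show "p \<in> order_ge d"
    using order_ge_diff [of "subst Y p" d "subst Y p - p"] vanish by (simp add: subst_identity)
qed

theorem mainTheorem1:
  fixes n k :: nat
    and h :: "nat \<Rightarrow> (nat word \<Rightarrow>\<^sub>0 'k::field)"
    and A :: "('k, (nat word \<Rightarrow>\<^sub>0 'k) set) module"
    and g :: "nat \<Rightarrow> (nat word \<Rightarrow>\<^sub>0 'k) set"
  assumes relations: "\<And>j. j < k \<Longrightarrow> h j \<in> carrier (free_nalg (n + k))"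
    and presentation:
      "A = nalg_quot (free_nalg (n + k)) (nalg_genideal (free_nalg (n + k)) (h ` {..<k}))"
    and generators: "nalg_generates A n g"
  shows "nalg_isomorphic A (free_nalg n)"
proof -
  let ?F = "free_nalg (n + k) :: ('k, nat word \<Rightarrow>\<^sub>0 'k) module"
  define I where "I = nalg_genideal ?F (h ` {..<k})"
  define r where "r = (\<lambda>p. I +>\<^bsub>?F\<^esub> p)"
  have I: "nalg_ideal ?F I"
    unfolding I_def using relations
    by (intro nalg_ideal_genideal free_nalg_nonunital_algebra) auto
  have A: "A = nalg_quot ?F I"
    by (simp add: presentation I_def)
  have alg: "nonunital_algebra A"
    unfolding A by (intro nalg_quot_nonunital_algebra free_nalg_nonunital_algebra I)
  have r: "r \<in> nalg_hom ?F A"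
    unfolding r_def A by (rule coset_map_hom [OF I])
  have car: "carrier A = r ` carrier ?F"
    by (auto simp: A nalg_quot_def A_RCOSETS_def' r_def)
  have r_eq: "r p = r q \<longleftrightarrow> p - q \<in> I" for p q
    by (simp add: r_def coset_free_nalg_eq_iff [OF I])
  have "\<forall>i<n. \<exists>x. x \<in> carrier ?F \<and> g i = r x"
    using generators by (auto simp: nalg_generates_def car)
  then obtain G where G: "\<And>i. i < n \<Longrightarrow> G i \<in> carrier ?F" and gG: "\<And>i. i < n \<Longrightarrow> g i = r (G i)"
    by metis
  \<comment> \<open>The homomorphism from the free algebra that sends the \<open>i\<close>-th
    variable to \<open>g i\<close>; it remains to see that it is bijective.\<close>
  define f where "f = (\<lambda>p. r (subst G p))"
  have f: "f \<in> nalg_hom (free_nalg n) A"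
    unfolding f_def using r G by (rule nalg_hom_comp_subst)
  have surj: "\<exists>p\<in>carrier (free_nalg n). a = f p" if "a \<in> carrier A" for a
    using generators that nalg_eval_hom [OF alg r _ G gG]
    by (fastforce simp: nalg_generates_def f_def)
  \<comment> \<open>Surjectivity at the class of each variable supplies the generation hypothesis of
    \<open>subst_in_genideal_imp_zero\<close>.\<close>
  have "\<exists>q\<in>carrier (free_nalg n). var a - subst G q \<in> I" if "a < n + k" for a
  proof -
    have "var a \<in> carrier ?F"
      using that by (simp add: carrier_free_nalg_iff var_def)
    then show ?thesis
      using surj [of "r (var a)"] by (auto simp: car f_def r_eq)
  qed
  then have kernel: "p = 0" if "p \<in> carrier (free_nalg n)" "subst G p \<in> I" for p
    using subst_in_genideal_imp_zero [where h = h and G = G, OF relations G] that unfolding I_def by blast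
  have "inj_on f (carrier (free_nalg n))"
  proof (rule inj_onI)
    fix p q :: "nat word \<Rightarrow>\<^sub>0 'k"
    assume pq: "p \<in> carrier (free_nalg n)" "q \<in> carrier (free_nalg n)" and "f p = f q"
    then have "subst G (p - q) \<in> I"
      by (simp add: f_def r_eq subst_diff)
    moreover have "p - q \<in> carrier (free_nalg n)"
      using pq Poly_Mapping.keys_diff [of p q] by (fastforce simp: carrier_free_nalg_iff)
    ultimately show "p = q"
      using kernel by force
  qed
  then have "bij_betw f (carrier (free_nalg n)) (carrier A)"
    using f surj by (auto simp: bij_betw_def nalg_hom_def)
  with f have "nalg_isomorphic (free_nalg n) A"
    by (auto simp: nalg_isomorphic_def)
  then show ?thesis
    by (rule nalg_isomorphic_sym [OF free_nalg_nonunital_algebra])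
qed

end
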